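(* Let $H(x_1,\dots,x_n)=\dfrac{\mathbf{n}(x_1,\dots,x_n)}{\mathbf{d}(x_1,\dots,x_n)}$ be a rational function in $n\ge 2$ variables, where $\mathbf{n},\mathbf{d}$ are polynomials with complex coefficients, $\mathbf d\ne 0$, and $H$ has degree $k_l-1$ in the variable $x_l$ (that is, the maximum of the degrees of $\mathbf n$ and $\mathbf d$ in $x_l$ is $k_l-1$), $l=1,\dots,n$. For each $l$ let $\lambda_l(1),\dots,\lambda_l(k_l)\in\mathbb{C}$ be mutually distinct. Assume that for every $l=2,\dots,n$ and all $j_1,\dots,j_{l-1}$ with $1\le j_i\le k_i$, both $\mathbf n$ and $\mathbf d$ are nonzero at the point $(\lambda_1(j_1),\dots,\lambda_{l-1}(j_{l-1}),\lambda_l(k_l),\dots,\lambda_n(k_n))$. For $l=1,\dots,n$ define the vectors of single-variable polynomials of length $N=k_1k_2\cdots k_n$ $$\Phi_l(x_l)=\big(\mathrm{Bary}^{\mathrm{den}}_{x_l}\otimes \mathbf 1_{k_{l+1}\cdots k_n}\big)\odot\big(\mathbf 1_{k_1\cdots k_{l-1}}\otimes X_l\otimes \mathbf 1_{k_{l+1}\cdots k_n}\big),$$ $$\widehat\Phi_l(x_l)=\big(\mathrm{Bary}^{\mathrm{num}}_{x_l}\otimes \mathbf 1_{k_{l+1}\cdots k_n}\big)\odot\big(\mathbf 1_{k_1\cdots k_{l-1}}\otimes X_l\otimes \mathbf 1_{k_{l+1}\cdots k_n}\big).$$ Then $$H(x_1,\dots,x_n)=\frac{\sum_{r=1}^{N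}\big(\widehat\Phi_1(x_1)\odot\cdots\odot\widehat\Phi_n(x_n)\big)_r}{\sum_{r=1}^{N}\big(\Phi_1(x_1)\odot\cdots\odot\Phi_n(x_n)\big)_r}.$$
   Context: $\otimes$ is the Kronecker product, $\odot$ the entrywise (Hadamard) product, $\mathbf 1_m$ the all-ones column vector of length $m$ (with $\mathbf 1_m=1$ when the index is an empty product). $X_l$ is the column vector of length $k_l$ of normalized Lagrange polynomials in the variable $x_l$: its $j$-th entry is $\prod_{1\le i\le k_l,\ i\ne j}\frac{x_l-\lambda_l(i)}{\lambda_l(j)-\lambda_l(i)}$. For a polynomial $p\in\{\mathbf n,\mathbf d\}$, the associated vector $\mathrm{Bary}_{x_l}$ (written $\mathrm{Bary}^{\mathrm{num}}_{x_l}$ for $p=\mathbf n$ and $\mathrm{Bary}^{\mathrm{den}}_{x_l}$ for $p=\mathbf d$) of normalized barycentric weights (values) is defined as follows. For $l=1$ it is the vector of length $k_1$ with entries $p(\lambda_1(j_1),\lambda_2(k_2),\dots,\lambda_n(k_n))$, $j_1=1,\dots,k_1$ (no normalization for the first variable). For $l\ge 2$ it is the vector of length $k_1\cdots k_l$, with entries indexed by $(j_1,\dots,j_l)$ in lexicographic order (the last index varying fastest), equal to $$\frac{p(\lambda_1(j_1),\dots,\lambda_{l-1}(j_{l-1}),\lambda_l(j_l),\lambda_{l+1}(k_{l+1}),\dots,\lambda_n(k_n))}{p(\lambda_1(j_1),\dots,\lambda_{l-1}(j_{l-1}),\lambda_l(k_l),\lambda_{l+1}(k_{l+1}),\dots,\lambda_n(k_n))}.$$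 Thus it consists of $k_1\cdots k_{l-1}$ blocks of length $k_l$, each normalized so that its last entry equals $1$. *)

theory Defs
  imports
    Complex_Main
    "HOL-Library.Poly_Mapping"
    "HOL-Computational_Algebra.Fraction_Field"
    "Jordan_Normal_Form.Matrix"
begin

(* Monomials are finitely supported exponent functions on the variable indices, and
   polynomials are finitely supported coefficient functions on monomials. Polynomials in
   x_1, ..., x_n are those with mp_vars p <= {1..n}; rational functions are elements of the
   type cmpoly fract. *)
type_synonym cmpoly = "(nat \<Rightarrow>\<^sub>0 nat) \<Rightarrow>\<^sub>0 complex"

definition mp_const :: "complex \<Rightarrow> cmpoly" where
  "mp_const c = Poly_Mapping.single 0 c"

definition mp_var :: "nat \<Rightarrow> cmpoly" where
  "mp_var i = Poly_Mapping.single (Poly_Mapping.single i 1) 1"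

definition mp_vars :: "cmpoly \<Rightarrow> nat set" where
  "mp_vars p = (\<Union>m\<in>Poly_Mapping.keys p. Poly_Mapping.keys m)"

definition mp_eval :: "cmpoly \<Rightarrow> (nat \<Rightarrow> complex) \<Rightarrow> complex" where
  "mp_eval p x = (\<Sum>m\<in>Poly_Mapping.keys p.
     Poly_Mapping.lookup p m * (\<Prod>i\<in>Poly_Mapping.keys m. x i ^ Poly_Mapping.lookup m i))"

(* Degree in the variable x_i, with value 0 for the zero polynomial. *)
definition mp_degree_in :: "nat \<Rightarrow> cmpoly \<Rightarrow> nat" where
  "mp_degree_in i p = Max (insert 0 ((\<lambda>m. Poly_Mapping.lookup m i) ` Poly_Mapping.keys p))"


definition kron_vec :: "'a::times vec \<Rightarrow> 'a vec \<Rightarrow> 'a vec" (infixl \<open>\<otimes>\<^sub>v\<close> 75) where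
  "u \<otimes>\<^sub>v v = vec (dim_vec u * dim_vec v) (\<lambda>i. u $ (i div dim_vec v) * v $ (i mod dim_vec v))"

(* Only meant for vectors of equal dimension. *)
definition hadamard_vec :: "'a::times vec \<Rightarrow> 'a vec \<Rightarrow> 'a vec" (infixl \<open>\<odot>\<^sub>v\<close> 70) where
  "u \<odot>\<^sub>v v = vec (dim_vec u) (\<lambda>i. u $ i * v $ i)"

definition ones_vec :: "nat \<Rightarrow> 'a::one vec" where
  "ones_vec m = vec m (\<lambda>_. 1)"

(* F 1 \<odot> F 2 \<odot> ... \<odot> F n, for n >= 1 *)
definition hadamard_all :: "(nat \<Rightarrow> 'a::times vec) \<Rightarrow> nat \<Rightarrow> 'a vec" where
  "hadamard_all F n = foldl (\<odot>\<^sub>v) (F 1) (map F [2..<Suc n])"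


(* Variables, multi-indices and interpolation nodes are numbered from 1, whereas the entries
   of a vec are numbered from 0; hence the shifts by one below. *)

definition lagrange_vec :: "(nat \<Rightarrow> nat) \<Rightarrow> (nat \<Rightarrow> nat \<Rightarrow> complex) \<Rightarrow> nat \<Rightarrow> cmpoly vec" where
  "lagrange_vec k lam l = vec (k l) (\<lambda>r. let j = r + 1 in
     \<Prod>i\<in>{1..k l} - {j}.
       mp_const (1 / (lam l j - lam l i)) * (mp_var l - mp_const (lam l i)))"

(* The component j_i of the r-th (from 0) multi-index (j_1, ..., j_l), 1 <= j_i <= k i, in
   lexicographic order with j_l varying fastest. *)
definition lex_index :: "(nat \<Rightarrow> nat) \<Rightarrow> nat \<Rightarrow> nat \<Rightarrow> nat \<Rightarrow> nat" where
  "lex_index k l r i = (r div (\<Prod>q\<in>{i<..l}. k q)) mod k i + 1"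

(* (lam_1(j_1), ..., lam_l(j_l), lam_(l+1)(k_(l+1)), ..., lam_n(k_n)) *)
definition node_point ::
    "(nat \<Rightarrow> nat) \<Rightarrow> (nat \<Rightarrow> nat \<Rightarrow> complex) \<Rightarrow> nat \<Rightarrow> (nat \<Rightarrow> nat) \<Rightarrow> nat \<Rightarrow> complex" where
  "node_point k lam l j = (\<lambda>i. if i \<le> l then lam i (j i) else lam i (k i))"

definition bary_vec ::
    "(nat \<Rightarrow> nat) \<Rightarrow> (nat \<Rightarrow> nat \<Rightarrow> complex) \<Rightarrow> cmpoly \<Rightarrow> nat \<Rightarrow> complex vec" where
  "bary_vec k lam p l = vec (\<Prod>i\<in>{1..l}. k i) (\<lambda>r. let j = lex_index k l r in
     if l = 1 then mp_eval p (node_point k lam 1 j)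
     else mp_eval p (node_point k lam l j) / mp_eval p (node_point k lam (l - 1) j))"

(* For p the denominator this is Phi_l, for p the numerator it is Phi_l-hat. *)
definition Phi_vec ::
    "nat \<Rightarrow> (nat \<Rightarrow> nat) \<Rightarrow> (nat \<Rightarrow> nat \<Rightarrow> complex) \<Rightarrow> cmpoly \<Rightarrow> nat \<Rightarrow> cmpoly vec" where
  "Phi_vec n k lam p l =
     (map_vec mp_const (bary_vec k lam p l) \<otimes>\<^sub>v ones_vec (\<Prod>i\<in>{l<..n}. k i))
     \<odot>\<^sub>v (ones_vec (\<Prod>i\<in>{1..<l}. k i) \<otimes>\<^sub>v lagrange_vec k lam l \<otimes>\<^sub>v ones_vec (\<Prod>i\<in>{l<..n}. k i))"

end

theory Submission
  imports Defs "HOL-Computational_Algebra.Polynomial"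
begin

text \<open>
  Both sums in the quotient are equal to the polynomials they are built from: for
  \<open>p\<close> the numerator or the denominator, summing the entries of the Hadamard product of
  the vectors attached to \<open>p\<close> gives back \<open>p\<close> (lemma \<open>sum_hadamard_Phi\<close>). The theorem
  follows at once, including the fact that the new denominator is not zero.

  Fix an entry \<open>r\<close> and let \<open>(j\<^sub>1, \<dots>, j\<^sub>n)\<close> be its multi-index. The constant factors of
  that entry are consecutive quotients of the values of \<open>p\<close> at points obtained from
  \<open>(\<lambda>\<^sub>1(k\<^sub>1), \<dots>, \<lambda>\<^sub>n(k\<^sub>n))\<close> by changing one coordinate after the other into
  \<open>\<lambda>\<^sub>l(j\<^sub>l)\<close>. The nonvanishing hypotheses say that the intermediate values can be
  cancelled, so the product telescopes to the value of \<open>p\<close> at the grid point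
  \<open>(\<lambda>\<^sub>1(j\<^sub>1), \<dots>, \<lambda>\<^sub>n(j\<^sub>n))\<close>. The remaining factors are the Lagrange basis
  polynomials, one for each variable. Hence the sum is the tensor-product Lagrange interpolant
  of \<open>p\<close>, and the degree bound \<open>k\<^sub>l - 1\<close> in each variable makes it exact
  (lemma \<open>grid_interpolation\<close>).

  Exactness needs only interpolation in one variable: \<open>p\<close> is a combination of monomials, and
  for a monomial the sum over the grid is a product of one-variable sums
  (lemma \<open>sum_prod_lex_index\<close>), each of which reproduces a power of one variable.
\<close>

section \<open>Univariate Lagrange interpolation\<close>

text \<open>
  The interpolant and \<open>q\<close> both have degree below the number of nodes and agree at the nodes.
  The base ring is an arbitrary integral domain, with \<open>c j i\<close> a given inverse of
  \<open>a j - a i\<close>, so that the nodes and the evaluation point may themselves be multivariate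
  polynomials: the nodes will be constants, and \<open>x\<close> one of the variables.
\<close>
lemma lagrange_interpolation:
  fixes a :: "'i \<Rightarrow> 'a::idom" and c :: "'i \<Rightarrow> 'i \<Rightarrow> 'a"
  assumes fin: "finite I"
    and c: "\<And>i j. i \<in> I \<Longrightarrow> j \<in> I \<Longrightarrow> i \<noteq> j \<Longrightarrow> c j i * (a j - a i) = 1"
    and deg: "degree q < card I"
  shows "(\<Sum>j\<in>I. poly q (a j) * (\<Prod>i\<in>I - {j}. c j i * (x - a i))) = poly q x"
proof -
  define L where "L j = (\<Prod>i\<in>I - {j}. smult (c j i) [:- a i, 1:])" for j
  define Q where "Q = (\<Sum>j\<in>I. smult (poly q (a j)) (L j))"
  have polyL: "poly (L j) y = (\<Prod>i\<in>I - {j}. c j i * (y - a i))" for j y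
    by (simp add: L_def poly_prod algebra_simps)
  have inj: "inj_on a I"
  proof (rule inj_onI, rule ccontr)
    fix i j assume "i \<in> I" "j \<in> I" "a i = a j" "i \<noteq> j"
    then show False using c[of i j] by simp
  qed
  have degL: "degree (L j) \<le> card I - 1" if "j \<in> I" for j
  proof -
    have "degree (L j) \<le> (\<Sum>i\<in>I - {j}. degree (smult (c j i) [:- a i, 1:]))"
      unfolding L_def using degree_prod_sum_le[of "I - {j}"] fin unfolding o_def by blast
    also have "\<dots> \<le> (\<Sum>i\<in>I - {j}. 1)"
      by (rule sum_mono) (use degree_smult_le in \<open>simp\<close>)
    finally show ?thesis using that fin by simp
  qed
  have "degree Q \<le> card I - 1"
    unfolding Q_def using fin degL by (intro degree_sum_le) (auto intro: order.trans[OF degree_smult_le])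
  then have degQ: "degree Q < card I" using deg by linarith
  have "poly Q y = poly q y" if y: "y \<in> a ` I" for y
  proof -
    from y obtain m where m: "m \<in> I" "y = a m" by blast
    have L0: "poly (L j) (a m) = (if j = m then 1 else 0)" if "j \<in> I" for j
    proof (cases "j = m")
      case True
      then show ?thesis using c m by (simp add: polyL)
    next
      case False
      then have "\<exists>i\<in>I - {j}. c j i * (a m - a i) = 0"
        using m by (intro bexI[of _ m]) auto
      then show ?thesis using False fin by (simp add: polyL prod_zero_iff)
    qed
    have "poly Q y = (\<Sum>j\<in>I. if j = m then poly q (a j) else 0)"
      unfolding Q_def poly_sum m by (rule sum.cong) (auto simp: L0)
    then show ?thesis using m fin by simp
  qed
  then have "Q = q"
    by (rule poly_eqI_degree[where A = "a ` I"]) (use degQ deg inj in \<open>simp_all add: card_image\<close>)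
  then have "poly q x = poly Q x" by simp
  then show ?thesis by (simp add: Q_def poly_sum polyL)
qed

section \<open>Polynomials as combinations of monomials\<close>

lemma mp_const_0: "mp_const 0 = 0"
  and mp_const_1: "mp_const 1 = 1"
  and mp_const_add: "mp_const (a + b) = mp_const a + mp_const b"
  and mp_const_diff: "mp_const (a - b) = mp_const a - mp_const b"
  and mp_const_mult: "mp_const (a * b) = mp_const a * mp_const b"
  by (simp_all add: mp_const_def single_add single_diff mult_single)

lemma mp_const_power: "mp_const (a ^ e) = mp_const a ^ e"
  by (induction e) (simp_all add: mp_const_1 mp_const_mult)

lemma mp_const_sum: "mp_const (sum f A) = (\<Sum>x\<in>A. mp_const (f x))"
  by (induction A rule: infinite_finite_induct) (simp_all add: mp_const_0 mp_const_add)

lemma mp_const_prod: "mp_const (prod f A) = (\<Prod>x\<in>A. mp_const (f x))"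
  by (induction A rule: infinite_finite_induct) (simp_all add: mp_const_1 mp_const_mult)

lemma mp_var_power: "mp_var i ^ e = Poly_Mapping.single (Poly_Mapping.single i e) 1"
  by (induction e) (simp_all add: mp_var_def mult_single single_add[symmetric])

lemma poly_mapping_eq_sum_single:
  assumes "finite A" "Poly_Mapping.keys p \<subseteq> A"
  shows "p = (\<Sum>x\<in>A. Poly_Mapping.single x (Poly_Mapping.lookup p x))"
proof (rule poly_mapping_eqI)
  fix y
  have "(\<Sum>x\<in>A. Poly_Mapping.lookup p x when x = y) = (if y \<in> A then Poly_Mapping.lookup p y else 0)"
    using assms(1) by (simp add: when_def)
  then show "Poly_Mapping.lookup p y =
      Poly_Mapping.lookup (\<Sum>x\<in>A. Poly_Mapping.single x (Poly_Mapping.lookup p x)) y"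
    using assms(2) by (auto simp: lookup_sum lookup_single in_keys_iff)
qed

lemma prod_mp_var_power:
  assumes "finite A" "Poly_Mapping.keys m \<subseteq> A"
  shows "(\<Prod>i\<in>A. mp_var i ^ Poly_Mapping.lookup m i) = Poly_Mapping.single m 1"
proof -
  have "(\<Prod>i\<in>A. mp_var i ^ f i) = Poly_Mapping.single (\<Sum>i\<in>A. Poly_Mapping.single i (f i)) 1" for f
    using assms(1) by (induction A) (simp_all add: mp_var_power mult_single)
  then show ?thesis using poly_mapping_eq_sum_single[OF assms] by simp
qed

lemma mp_eq_sum_monomials:
  assumes "finite A" "mp_vars p \<subseteq> A"
  shows "p = (\<Sum>m\<in>Poly_Mapping.keys p.
    mp_const (Poly_Mapping.lookup p m) * (\<Prod>i\<in>A. mp_var i ^ Poly_Mapping.lookup m i))"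
proof -
  have "Poly_Mapping.single m (Poly_Mapping.lookup p m) =
      mp_const (Poly_Mapping.lookup p m) * (\<Prod>i\<in>A. mp_var i ^ Poly_Mapping.lookup m i)"
    if "m \<in> Poly_Mapping.keys p" for m
  proof -
    have "Poly_Mapping.keys m \<subseteq> A" using that assms(2) by (auto simp: mp_vars_def)
    then show ?thesis by (simp add: prod_mp_var_power assms(1) mp_const_def mult_single)
  qed
  then show ?thesis
    using poly_mapping_eq_sum_single[of "Poly_Mapping.keys p" p] by simp
qed

lemma mp_eval_eq_sum:
  assumes "finite A" "mp_vars p \<subseteq> A"
  shows "mp_eval p x = (\<Sum>m\<in>Poly_Mapping.keys p.
    Poly_Mapping.lookup p m * (\<Prod>i\<in>A. x i ^ Poly_Mapping.lookup m i))"
  unfolding mp_eval_def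
proof (rule sum.cong[OF refl])
  fix m assume "m \<in> Poly_Mapping.keys p"
  then have "Poly_Mapping.keys m \<subseteq> A" using assms(2) by (auto simp: mp_vars_def)
  then have "(\<Prod>i\<in>Poly_Mapping.keys m. x i ^ Poly_Mapping.lookup m i) =
      (\<Prod>i\<in>A. x i ^ Poly_Mapping.lookup m i)"
    using assms(1) by (intro prod.mono_neutral_left) (auto simp: in_keys_iff)
  then show "Poly_Mapping.lookup p m * (\<Prod>i\<in>Poly_Mapping.keys m. x i ^ Poly_Mapping.lookup m i) =
      Poly_Mapping.lookup p m * (\<Prod>i\<in>A. x i ^ Poly_Mapping.lookup m i)" by simp
qed

lemma lookup_le_mp_degree_in:
  assumes "m \<in> Poly_Mapping.keys p"
  shows "Poly_Mapping.lookup m i \<le> mp_degree_in i p"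
  unfolding mp_degree_in_def using assms by (intro Max_ge) auto

section \<open>Interpolation on the grid\<close>

definition lagrange_poly :: "(nat \<Rightarrow> nat) \<Rightarrow> (nat \<Rightarrow> nat \<Rightarrow> complex) \<Rightarrow> nat \<Rightarrow> nat \<Rightarrow> cmpoly" where
  "lagrange_poly k lam l j =
     (\<Prod>i\<in>{1..k l} - {j}. mp_const (1 / (lam l j - lam l i)) * (mp_var l - mp_const (lam l i)))"

text \<open>The nodes are constants whose differences are invertible, so the general interpolation
  lemma applies over the ring of multivariate polynomials itself, at \<open>x = x\<^sub>l\<close>.\<close>
lemma lagrange_poly_power:
  assumes "inj_on (lam l) {1..k l}" "e < k l"
  shows "(\<Sum>j=1..k l. mp_const (lam l j ^ e) * lagrange_poly k lam l j) = mp_var l ^ e"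
proof -
  have "mp_const (1 / (lam l j - lam l i)) * (mp_const (lam l j) - mp_const (lam l i)) = 1"
    if "i \<in> {1..k l}" "j \<in> {1..k l}" "i \<noteq> j" for i j
  proof -
    have "lam l j - lam l i \<noteq> 0" using that assms(1) by (auto dest: inj_onD)
    then show ?thesis
      by (simp add: mp_const_diff[symmetric] mp_const_mult[symmetric] mp_const_1)
  qed
  then show ?thesis
    using lagrange_interpolation[of "{1..k l}" "\<lambda>j i. mp_const (1 / (lam l j - lam l i))"
        "\<lambda>j. mp_const (lam l j)" "monom 1 e" "mp_var l"] assms(2)
    by (simp add: degree_monom_eq poly_monom mp_const_power lagrange_poly_def)
qed

text \<open>
  Dropping the digits of \<open>r\<close> that belong to the variables after \<open>l\<close> leaves the digits of the
  first \<open>l\<close> variables unchanged. This is why tensoring a vector over the first \<open>l\<close> variables with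
  ones makes it depend on the first \<open>l\<close> components of the full multi-index.
\<close>
lemma lex_index_div:
  assumes "i \<le> l" "l \<le> n"
  shows "lex_index k l (r div (\<Prod>q\<in>{l<..n}. k q)) i = lex_index k n r i"
proof -
  have "{i<..n} = {i<..l} \<union> {l<..n}" using assms by auto
  then have "(\<Prod>q\<in>{i<..n}. k q) = (\<Prod>q\<in>{l<..n}. k q) * (\<Prod>q\<in>{i<..l}. k q)"
    by (simp add: prod.union_disjoint Int_commute mult.commute)
  then show ?thesis by (simp add: lex_index_def div_mult2_eq)
qed

lemma lex_index_in_range:
  assumes "k i \<ge> 1"
  shows "lex_index k n r i \<in> {1..k i}"
  using assms mod_less_divisor[of "k i"] by (simp add: lex_index_def Suc_le_eq)

text \<open>
  The distributive law, with the multi-indices enumerated by mixed-radix numbers. Splitting off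
  the last digit turns the range of \<open>r\<close> into consecutive blocks of length \<open>k n\<close>, which allows
  an induction on \<open>n\<close> without an explicit bijection to multi-indices.
\<close>
lemma sum_prod_lex_index:
  fixes f :: "nat \<Rightarrow> nat \<Rightarrow> 'a::comm_semiring_1"
  assumes "\<And>i. i \<in> {1..n} \<Longrightarrow> k i \<ge> 1"
  shows "(\<Sum>r<(\<Prod>i=1..n. k i). \<Prod>i=1..n. f i (lex_index k n r i)) = (\<Prod>i=1..n. \<Sum>j=1..k i. f i j)"
  using assms
proof (induction n)
  case 0
  then show ?case by simp
next
  case (Suc n)
  define K where "K = k (Suc n)"
  define g where "g r = (\<Prod>i=1..n. f i (lex_index k n r i))" for r
  have K: "K \<ge> 1" using Suc.prems[of "Suc n"] by (simp add: K_def)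
  have idx: "lex_index k (Suc n) r i = lex_index k n (r div K) i" if "i \<in> {1..n}" for i r
  proof -
    have "{n<..Suc n} = {Suc n}" by auto
    then show ?thesis using lex_index_div[of i n "Suc n" k r] that by (simp add: K_def)
  qed
  have split: "(\<Prod>i=1..Suc n. f i (lex_index k (Suc n) r i)) =
      g (r div K) * f (Suc n) (r mod K + 1)" for r
  proof -
    have "(\<Prod>i=1..n. f i (lex_index k (Suc n) r i)) = g (r div K)"
      unfolding g_def by (rule prod.cong) (simp_all only: idx)
    then show ?thesis by (simp add: lex_index_def K_def)
  qed
  have inner: "(\<Sum>r\<in>{m*K..<m*K+K}. g (r div K) * f (Suc n) (r mod K + 1)) =
      g m * (\<Sum>j=1..K. f (Suc n) j)" for m
  proof -
    have "(\<Sum>r\<in>{m*K..<m*K+K}. g (r div K) * f (Suc n) (r mod K + 1)) =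
        (\<Sum>s\<in>{0..<K}. g ((s + m*K) div K) * f (Suc n) ((s + m*K) mod K + 1))"
      using sum.shift_bounds_nat_ivl[of "\<lambda>r. g (r div K) * f (Suc n) (r mod K + 1)" 0 "m*K" K]
      by (simp add: add.commute)
    also have "\<dots> = (\<Sum>s\<in>{0..<K}. g m * f (Suc n) (s + 1))"
      using K by (intro sum.cong) auto
    also have "\<dots> = g m * (\<Sum>j=1..K. f (Suc n) j)"
      using sum.shift_bounds_Suc_ivl[of "f (Suc n)" 0 K]
      by (simp add: sum_distrib_left atLeastLessThanSuc_atLeastAtMost)
    finally show ?thesis .
  qed
  have "(\<Sum>r<(\<Prod>i=1..Suc n. k i). \<Prod>i=1..Suc n. f i (lex_index k (Suc n) r i)) =
      (\<Sum>r<(\<Prod>i=1..n. k i) * K. g (r div K) * f (Suc n) (r mod K + 1))"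
    unfolding split by (simp add: K_def)
  also have "\<dots> = (\<Sum>m<(\<Prod>i=1..n. k i). g m * (\<Sum>j=1..K. f (Suc n) j))"
    unfolding sum.nat_group[symmetric] inner ..
  also have "\<dots> = (\<Prod>i=1..Suc n. \<Sum>j=1..k i. f i j)"
    using Suc by (simp add: g_def K_def sum_distrib_right[symmetric])
  finally show ?case .
qed

text \<open>
  After expanding \<open>p\<close> into monomials, both its values at the grid points and the products of
  basis polynomials separate into one factor per variable.
\<close>
lemma grid_interpolation:
  assumes vars: "mp_vars p \<subseteq> {1..n}"
    and k: "\<And>l. l \<in> {1..n} \<Longrightarrow> k l \<ge> 1"
    and deg: "\<And>l. l \<in> {1..n} \<Longrightarrow> mp_degree_in l p \<le> k l - 1"
    and inj: "\<And>l. l \<in> {1..n} \<Longrightarrow> inj_on (lam l) {1..k l}"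
  shows "(\<Sum>r<(\<Prod>l=1..n. k l). mp_const (mp_eval p (node_point k lam n (lex_index k n r))) *
    (\<Prod>l=1..n. lagrange_poly k lam l (lex_index k n r l))) = p"
proof -
  let ?c = "Poly_Mapping.lookup p" and ?e = "Poly_Mapping.lookup :: (nat \<Rightarrow>\<^sub>0 nat) \<Rightarrow> _"
  let ?f = "\<lambda>m l j. mp_const (lam l j ^ ?e m l) * lagrange_poly k lam l j"
  have "mp_const (mp_eval p (node_point k lam n j)) * (\<Prod>l=1..n. lagrange_poly k lam l (j l)) =
      (\<Sum>m\<in>Poly_Mapping.keys p. mp_const (?c m) * (\<Prod>l=1..n. ?f m l (j l)))" for j
    by (simp add: mp_eval_eq_sum[OF _ vars] node_point_def mp_const_sum mp_const_mult
        mp_const_prod prod.distrib sum_distrib_right mult.assoc)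
  then have "(\<Sum>r<(\<Prod>l=1..n. k l). mp_const (mp_eval p (node_point k lam n (lex_index k n r))) *
        (\<Prod>l=1..n. lagrange_poly k lam l (lex_index k n r l))) =
      (\<Sum>m\<in>Poly_Mapping.keys p. mp_const (?c m) *
        (\<Sum>r<(\<Prod>l=1..n. k l). \<Prod>l=1..n. ?f m l (lex_index k n r l)))"
    by (simp add: sum_distrib_left sum.swap[of _ "Poly_Mapping.keys p"])
  also have "\<dots> = (\<Sum>m\<in>Poly_Mapping.keys p. mp_const (?c m) * (\<Prod>l=1..n. mp_var l ^ ?e m l))"
  proof (intro sum.cong refl arg_cong2[of _ _ _ _ "(*)"])
    fix m assume m: "m \<in> Poly_Mapping.keys p"
    have "?e m l < k l" if "l \<in> {1..n}" for l
      using lookup_le_mp_degree_in[OF m, of l] deg[OF that] k[OF that] by linarith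
    then have "(\<Prod>l=1..n. \<Sum>j=1..k l. ?f m l j) = (\<Prod>l=1..n. mp_var l ^ ?e m l)"
      using inj by (intro prod.cong refl lagrange_poly_power) auto
    then show "(\<Sum>r<(\<Prod>l=1..n. k l). \<Prod>l=1..n. ?f m l (lex_index k n r l)) =
        (\<Prod>l=1..n. mp_var l ^ ?e m l)"
      using sum_prod_lex_index[of n k "?f m"] k by simp
  qed
  also have "\<dots> = p" using mp_eq_sum_monomials[OF _ vars] by simp
  finally show ?thesis .
qed

section \<open>Entries of the Kronecker and Hadamard products\<close>

lemma prod_split_at:
  fixes k :: "nat \<Rightarrow> nat"
  assumes "l \<in> {1..n}"
  shows "(\<Prod>i=1..n. k i) = (\<Prod>i=1..l. k i) * (\<Prod>i\<in>{l<..n}. k i)"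
    and "(\<Prod>i=1..l. k i) = (\<Prod>i=1..<l. k i) * k l"
proof -
  have "{1..n} = {1..l} \<union> {l<..n}" "{1..l} \<inter> {l<..n} = {}" using assms by auto
  then show "(\<Prod>i=1..n. k i) = (\<Prod>i=1..l. k i) * (\<Prod>i\<in>{l<..n}. k i)"
    by (simp only: prod.union_disjoint finite_atLeastAtMost finite_greaterThanAtMost)
  have "{1..l} = insert l {1..<l}" using assms by auto
  then show "(\<Prod>i=1..l. k i) = (\<Prod>i=1..<l. k i) * k l"
    by (simp add: mult.commute)
qed

lemma index_kron_ones:
  fixes u :: "'a::monoid_mult vec"
  assumes "r < dim_vec u * b"
  shows "(u \<otimes>\<^sub>v ones_vec b) $ r = u $ (r div b)"
proof -
  have "b > 0" using assms by (cases b) auto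
  then show ?thesis using assms by (simp add: kron_vec_def ones_vec_def)
qed

lemma dim_ones_kron: "dim_vec (ones_vec a \<otimes>\<^sub>v u) = a * dim_vec u"
  by (simp add: kron_vec_def ones_vec_def)

lemma index_ones_kron:
  fixes u :: "'a::monoid_mult vec"
  assumes "r < a * dim_vec u"
  shows "(ones_vec a \<otimes>\<^sub>v u) $ r = u $ (r mod dim_vec u)"
  using assms by (simp add: kron_vec_def ones_vec_def less_mult_imp_div_less)

text \<open>
  The two Kronecker products pick out different parts of the mixed-radix number \<open>r\<close>: the
  weights see the first \<open>l\<close> digits, the Lagrange vector only the digit of variable \<open>l\<close>.
\<close>
lemma Phi_vec_index:
  assumes l: "l \<in> {1..n}" and r: "r < (\<Prod>i=1..n. k i)"
  shows "dim_vec (Phi_vec n k lam p l) = (\<Prod>i=1..n. k i)"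
    and "Phi_vec n k lam p l $ r =
      mp_const (bary_vec k lam p l $ (r div (\<Prod>i\<in>{l<..n}. k i))) *
      lagrange_poly k lam l (lex_index k n r l)"
proof -
  define b where "b = (\<Prod>i\<in>{l<..n}. k i)"
  define a where "a = (\<Prod>i=1..<l. k i)"
  have N: "(\<Prod>i=1..n. k i) = a * k l * b" and A: "(\<Prod>i=1..l. k i) = a * k l"
    using prod_split_at[OF l, of k] unfolding a_def b_def by argo+
  have dims: "dim_vec (bary_vec k lam p l) = a * k l" "dim_vec (lagrange_vec k lam l) = k l"
    unfolding bary_vec_def lagrange_vec_def A by simp_all
  show "dim_vec (Phi_vec n k lam p l) = (\<Prod>i=1..n. k i)"
    unfolding Phi_vec_def N by (simp add: hadamard_vec_def kron_vec_def ones_vec_def dims b_def)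
  have r': "r < a * k l * b" using r N by simp
  then have rb: "r div b < a * k l" by (simp add: less_mult_imp_div_less)
  then have kl: "k l > 0" by (cases "k l") auto
  have "lagrange_vec k lam l $ (r div b mod k l) = lagrange_poly k lam l (lex_index k n r l)"
    using kl by (simp add: lagrange_vec_def lagrange_poly_def lex_index_def b_def Let_def)
  moreover have "(ones_vec a \<otimes>\<^sub>v lagrange_vec k lam l \<otimes>\<^sub>v ones_vec b) $ r =
      lagrange_vec k lam l $ (r div b mod k l)"
    using r' rb by (subst index_kron_ones)
      (simp_all add: dim_ones_kron index_ones_kron dims)
  moreover have "(map_vec mp_const (bary_vec k lam p l) \<otimes>\<^sub>v ones_vec b) $ r =
      mp_const (bary_vec k lam p l $ (r div b))"
    using r' rb by (subst index_kron_ones) (simp_all add: dims)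
  moreover have "dim_vec (map_vec mp_const (bary_vec k lam p l) \<otimes>\<^sub>v (ones_vec b :: cmpoly vec)) = a * k l * b"
    by (simp add: kron_vec_def dims ones_vec_def)
  ultimately show "Phi_vec n k lam p l $ r =
      mp_const (bary_vec k lam p l $ (r div (\<Prod>i\<in>{l<..n}. k i))) *
      lagrange_poly k lam l (lex_index k n r l)"
    unfolding Phi_vec_def b_def[symmetric] a_def[symmetric]
    using r' by (simp add: hadamard_vec_def)
qed

lemma hadamard_all_index:
  fixes F :: "nat \<Rightarrow> 'a::comm_monoid_mult vec"
  assumes "n \<ge> 1" "r < dim_vec (F 1)"
  shows "hadamard_all F n $ r = (\<Prod>l=1..n. F l $ r)"
proof -
  have "dim_vec (hadamard_all F n) = dim_vec (F 1) \<and> hadamard_all F n $ r = (\<Prod>l=1..n. F l $ r)"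
    using assms(1)
  proof (induction n rule: dec_induct)
    case base
    then show ?case by (simp add: hadamard_all_def)
  next
    case (step n)
    have "hadamard_all F (Suc n) = hadamard_all F n \<odot>\<^sub>v F (Suc n)"
      using step(1) by (simp add: hadamard_all_def)
    then show ?case using step assms(2) by (simp add: hadamard_vec_def)
  qed
  then show ?thesis ..
qed

section \<open>Telescoping of the barycentric weights\<close>

lemma prod_telescope_quotients:
  fixes v :: "nat \<Rightarrow> 'a::field"
  assumes "n \<ge> 1" "\<And>l. l \<in> {2..n} \<Longrightarrow> v (l - 1) \<noteq> 0"
  shows "(\<Prod>l=1..n. if l = 1 then v 1 else v l / v (l - 1)) = v n"
  using assms
proof (induction n rule: dec_induct)
  case base
  then show ?case by simp
next
  case (step n)
  have "v n \<noteq> 0" using step.prems[of "Suc n"] step.hyps by simp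
  then show ?case using step by simp
qed

text \<open>
  Expressing every weight through the one full multi-index of \<open>r\<close> makes the weights for
  successive \<open>l\<close> consecutive terms of a telescoping product.
\<close>
lemma bary_vec_index:
  assumes l: "l \<in> {1..n}" and r: "r < (\<Prod>i=1..n. k i)"
  shows "bary_vec k lam p l $ (r div (\<Prod>i\<in>{l<..n}. k i)) =
    (if l = 1 then mp_eval p (node_point k lam 1 (lex_index k n r))
     else mp_eval p (node_point k lam l (lex_index k n r)) /
       mp_eval p (node_point k lam (l - 1) (lex_index k n r)))"
proof -
  define s where "s = r div (\<Prod>i\<in>{l<..n}. k i)"
  have "s < (\<Prod>i=1..l. k i)"
    using r unfolding s_def prod_split_at(1)[OF l, of k] by (rule less_mult_imp_div_less)
  moreover have "node_point k lam l' (lex_index k l s) = node_point k lam l' (lex_index k n r)"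
    if "l' \<le> l" for l'
    using that l by (auto simp: node_point_def s_def lex_index_div)
  ultimately show ?thesis
    using l unfolding s_def[symmetric] by (auto simp: bary_vec_def Let_def)
qed

text \<open>
  The normalization of the weights disappears in the product over all variables, leaving the
  values of \<open>p\<close> on the grid as coefficients of the tensor-product Lagrange basis.
\<close>
lemma sum_hadamard_Phi:
  assumes n: "n \<ge> 1"
    and vars: "mp_vars p \<subseteq> {1..n}"
    and k: "\<And>l. l \<in> {1..n} \<Longrightarrow> k l \<ge> 1"
    and deg: "\<And>l. l \<in> {1..n} \<Longrightarrow> mp_degree_in l p \<le> k l - 1"
    and inj: "\<And>l. l \<in> {1..n} \<Longrightarrow> inj_on (lam l) {1..k l}"
    and nz: "\<And>l j. l \<in> {2..n} \<Longrightarrow> (\<forall>i\<in>{1..l - 1}. j i \<in> {1..k i}) \<Longrightarrow>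
      mp_eval p (node_point k lam (l - 1) j) \<noteq> 0"
  shows "(\<Sum>r<(\<Prod>l=1..n. k l). hadamard_all (Phi_vec n k lam p) n $ r) = p"
proof -
  have "hadamard_all (Phi_vec n k lam p) n $ r =
      mp_const (mp_eval p (node_point k lam n (lex_index k n r))) *
      (\<Prod>l=1..n. lagrange_poly k lam l (lex_index k n r l))"
    if r: "r < (\<Prod>l=1..n. k l)" for r
  proof -
    let ?v = "\<lambda>l. mp_eval p (node_point k lam l (lex_index k n r))"
    have "(\<Prod>l=1..n. bary_vec k lam p l $ (r div (\<Prod>i\<in>{l<..n}. k i))) =
        (\<Prod>l=1..n. if l = 1 then ?v 1 else ?v l / ?v (l - 1))"
      using r by (intro prod.cong refl bary_vec_index)
    also have "\<dots> = ?v n"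
    proof (rule prod_telescope_quotients[OF n])
      fix l assume l: "l \<in> {2..n}"
      then have "\<forall>i\<in>{1..l - 1}. lex_index k n r i \<in> {1..k i}"
        using k by (intro ballI lex_index_in_range) auto
      with l show "?v (l - 1) \<noteq> 0" by (rule nz)
    qed
    finally have bary: "(\<Prod>l=1..n. bary_vec k lam p l $ (r div (\<Prod>i\<in>{l<..n}. k i))) = ?v n" .
    have "hadamard_all (Phi_vec n k lam p) n $ r = (\<Prod>l=1..n. Phi_vec n k lam p l $ r)"
      using n r by (intro hadamard_all_index) (simp_all add: Phi_vec_index)
    also have "\<dots> = (\<Prod>l=1..n. mp_const (bary_vec k lam p l $ (r div (\<Prod>i\<in>{l<..n}. k i))) *
        lagrange_poly k lam l (lex_index k n r l))"
      using r by (intro prod.cong refl Phi_vec_index)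
    finally show ?thesis by (simp only: prod.distrib mp_const_prod[symmetric] bary)
  qed
  then show ?thesis using grid_interpolation[OF vars k deg inj] by simp
qed

theorem mainTheorem2:
  fixes n :: nat
    and num den :: cmpoly
    and H :: "cmpoly fract"
    and k :: "nat \<Rightarrow> nat"
    and lam :: "nat \<Rightarrow> nat \<Rightarrow> complex"
    and N :: nat
  assumes "n \<ge> 2"
    and "mp_vars num \<subseteq> {1..n}" and "mp_vars den \<subseteq> {1..n}"
    and "den \<noteq> 0"
    and "H = Fraction_Field.Fract num den"
    and "\<And>l. l \<in> {1..n} \<Longrightarrow> k l \<ge> 1"
    and "\<And>l. l \<in> {1..n} \<Longrightarrow> max (mp_degree_in l num) (mp_degree_in l den) = k l - 1"
    and "\<And>l. l \<in> {1..n} \<Longrightarrow> inj_on (lam l) {1..k l}"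
    and "\<And>l j. l \<in> {2..n} \<Longrightarrow> (\<forall>i\<in>{1..l - 1}. j i \<in> {1..k i}) \<Longrightarrow>
           mp_eval num (node_point k lam (l - 1) j) \<noteq> 0 \<and>
           mp_eval den (node_point k lam (l - 1) j) \<noteq> 0"
    and "N = (\<Prod>l\<in>{1..n}. k l)"
  shows "(\<Sum>r<N. hadamard_all (Phi_vec n k lam den) n $ r) \<noteq> 0 \<and>
         H = Fraction_Field.Fract
           (\<Sum>r<N. hadamard_all (Phi_vec n k lam num) n $ r)
           (\<Sum>r<N. hadamard_all (Phi_vec n k lam den) n $ r)"
proof -
  have deg: "mp_degree_in l num \<le> k l - 1" "mp_degree_in l den \<le> k l - 1" if "l \<in> {1..n}" for l
    using assms(7)[OF that] by linarith+
  have "n \<ge> 1" using assms(1) by simp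
  have "(\<Sum>r<N. hadamard_all (Phi_vec n k lam num) n $ r) = num"
    unfolding assms(10)
    by (rule sum_hadamard_Phi[OF \<open>n \<ge> 1\<close> assms(2) assms(6) deg(1) assms(8)]) (use assms(9) in auto)
  moreover have "(\<Sum>r<N. hadamard_all (Phi_vec n k lam den) n $ r) = den"
    unfolding assms(10)
    by (rule sum_hadamard_Phi[OF \<open>n \<ge> 1\<close> assms(3) assms(6) deg(2) assms(8)]) (use assms(9) in auto)
  ultimately show ?thesis using assms(4,5) by simp
qed

end
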